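(* Let $j\ge 0$ be an integer. For every integer $n\ge 0$, the number of partitions of $n$ belonging to $\overline{\mathcal{M}}_j$ is equal to the number of partitions of $n$ belonging to $\overline{\mathcal{F}}_j$.
   Context: A partition is a finite non-increasing sequence $\lambda=(\lambda_1,\dots,\lambda_s)$ of positive integers (possibly empty); $\ell(\lambda)=s$ is its length and $|\lambda|=\lambda_1+\cdots+\lambda_s$ its weight; a partition of $n$ is a partition of weight $n$. For an integer $j\ge 0$, $mex_j(\lambda)$ is the smallest integer greater than $j$ which is not a part of $\lambda$ (defined for every partition $\lambda$, whether or not $j$ is a part of it). $\mathcal{M}_j$ is the set of partitions $\lambda$ such that $mex_j(\lambda)$ and $j$ have different parities, and $\mathcal{F}_j$ is the set of partitions $\lambda$ such that $j\notin\{\lambda_i-i : 1\le i\le \ell(\lambda)\}$. $\overline{\mathcal{M}}_j$ and $\overline{\mathcal{F}}_j$ are the complements of $\mathcal{M}_j$ and $\mathcal{F}_j$ in the set of all partitions. *)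

theory Defs
  imports Main
begin

definition partitions :: "nat list set" where
  "partitions = {xs. sorted_wrt (\<ge>) xs \<and> (\<forall>x\<in>set xs. 0 < x)}"

definition partitions_of :: "nat \<Rightarrow> nat list set" where
  "partitions_of n = {xs \<in> partitions. sum_list xs = n}"

definition mex :: "nat \<Rightarrow> nat list \<Rightarrow> nat" where
  "mex j xs = (LEAST m. j < m \<and> m \<notin> set xs)"

definition M_set :: "nat \<Rightarrow> nat list set" where
  "M_set j = {xs \<in> partitions. even (mex j xs) \<noteq> even j}"

text \<open>Parts are indexed from 1 as in the mathematics, hence the shift in the list index.
  The differences are integers, as they may be negative.\<close>

definition F_set :: "nat \<Rightarrow> nat list set" where
  "F_set j = {xs \<in> partitions.
     int j \<notin> {int (xs ! (i - 1)) - int i | i. 1 \<le> i \<and> i \<le> length xs}}"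

definition M_bar :: "nat \<Rightarrow> nat list set" where
  "M_bar j = partitions - M_set j"

definition F_bar :: "nat \<Rightarrow> nat list set" where
  "F_bar j = partitions - F_set j"

text \<open>Sanity check: \<^const>\<open>card\<close> really counts below, since the sets involved are finite.\<close>

lemma finite_partitions_of: "finite (partitions_of n)"
proof (rule finite_subset)
  have "length xs \<le> sum_list xs" if "\<forall>x\<in>set xs. 0 < x" for xs :: "nat list"
    using that by (induction xs) auto
  then show "partitions_of n \<subseteq> {xs. set xs \<subseteq> {..n} \<and> length xs \<le> n}"
    by (auto simp: partitions_of_def partitions_def intro: member_le_sum_list)
  show "finite {xs. set xs \<subseteq> {..n} \<and> length xs \<le> n}"
    by (rule finite_lists_length_le) simp
qed

end

theory Submission
  imports Defs
begin

text \<open>Removing one part \<^term>\<open>j + 1\<close> maps the partitions of \<^term>\<open>n + j + 1\<close> in \<^term>\<open>M_bar j\<close>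
  bijectively onto the partitions of \<^term>\<open>n\<close> in \<^term>\<open>M_set (j + 1)\<close>. Likewise, if
  \<^term>\<open>i + j\<close> is the \<^term>\<open>i\<close>-th part of a partition in \<^term>\<open>F_bar j\<close>, then deleting this part and
  increasing the \<^term>\<open>i - 1\<close> parts before it by one maps the partitions of \<^term>\<open>n + j + 1\<close> in
  \<^term>\<open>F_bar j\<close> bijectively onto the partitions of \<^term>\<open>n\<close> in \<^term>\<open>F_set (j + 1)\<close>. Hence
  both counts satisfy the same recursion, which relates \<^term>\<open>(n + j + 1, j)\<close> to
  \<^term>\<open>(n, j + 1)\<close>.\<close>

lemma partitions_of_iff:
  "xs \<in> partitions_of n \<longleftrightarrow> sorted_wrt (\<ge>) xs \<and> 0 \<notin> set xs \<and> sum_list xs = n"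
  by (auto simp: partitions_of_def partitions_def intro: gr0I)

section \<open>Partitions classified by the parity of the mex\<close>

lemma mex_Suc:
  assumes "Suc j \<in> set xs"
  shows "mex j xs = mex (Suc j) xs"
proof -
  have "j < m \<and> m \<notin> set xs \<longleftrightarrow> Suc j < m \<and> m \<notin> set xs" for m
    using assms by (metis Suc_lessD Suc_lessI)
  then show ?thesis
    by (simp add: mex_def)
qed

text \<open>If \<open>Suc j\<close> is missing, it is the mex itself and has the wrong parity.
  Otherwise the bound may move up to \<open>Suc j\<close>, which makes the parity condition
  independent of how often \<open>Suc j\<close> occurs.\<close>

lemma M_bar_iff:
  "xs \<in> M_bar j \<longleftrightarrow> xs \<in> partitions \<and> Suc j \<in> set xs \<and> even (mex (Suc j) xs) = even j"
proof (cases "Suc j \<in> set xs")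
  case True
  then show ?thesis
    by (auto simp: M_bar_def M_set_def mex_Suc)
next
  case False
  then have "mex j xs = Suc j"
    unfolding mex_def by (intro Least_equality) auto
  with False show ?thesis
    by (auto simp: M_bar_def M_set_def)
qed

lemma M_set_eq: "M_set j = partitions - M_bar j"
  by (auto simp: M_bar_def M_set_def)

lemma mex_cong:
  assumes "\<And>m. j < m \<Longrightarrow> m \<in> set xs \<longleftrightarrow> m \<in> set ys"
  shows "mex j xs = mex j ys"
proof -
  have "j < m \<and> m \<notin> set xs \<longleftrightarrow> j < m \<and> m \<notin> set ys" for m
    using assms by blast
  then show ?thesis
    by (simp add: mex_def)
qed

lemma card_M_bar:
  "card (partitions_of (n + Suc j) \<inter> M_bar j) = card (partitions_of n \<inter> M_set (Suc j))"
proof (rule bij_betw_same_card)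
  \<comment> \<open>\<open>remove1\<close> and \<open>insort\<close> are used on increasing lists,
    whereas partitions are decreasing; hence the reversals.\<close>
  let ?f = "\<lambda>xs. rev (remove1 (Suc j) (rev xs))" and ?g = "\<lambda>ys. rev (insort (Suc j) (rev ys))"
  have mex_f: "mex (Suc j) (?f xs) = mex (Suc j) xs" for xs
    by (rule mex_cong) simp
  have mex_g: "mex (Suc j) (?g xs) = mex (Suc j) xs" for xs
    by (rule mex_cong) (auto simp: set_insort_key)
  have sorted: "sorted_wrt (\<ge>) xs \<longleftrightarrow> sorted (rev xs)" for xs :: "nat list"
    by (simp add: sorted_wrt_rev)
  have sum_remove: "sum_list (remove1 a xs) + a = sum_list xs" if "a \<in> set xs" for a :: nat and xs
    using that by (induction xs) auto
  have sum_insort: "sum_list (insort a xs) = sum_list xs + a" for a :: nat and xs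
    by (induction xs) auto
  show "bij_betw ?f (partitions_of (n + Suc j) \<inter> M_bar j) (partitions_of n \<inter> M_set (Suc j))"
  proof (rule bij_betw_byWitness[where f' = ?g])
    show "\<forall>xs\<in>partitions_of (n + Suc j) \<inter> M_bar j. ?g (?f xs) = xs"
      by (auto simp: partitions_of_iff M_bar_iff sorted insort_remove1)
    show "\<forall>ys\<in>partitions_of n \<inter> M_set (Suc j). ?f (?g ys) = ys"
      by (simp add: remove1_insort_key)
    show "?f ` (partitions_of (n + Suc j) \<inter> M_bar j) \<subseteq> partitions_of n \<inter> M_set (Suc j)"
    proof safe
      fix xs assume xs: "xs \<in> partitions_of (n + Suc j)" "xs \<in> M_bar j"
      have "sum_list (?f xs) + Suc j = n + Suc j"
        using xs sum_remove[of "Suc j" "rev xs"] by (simp add: partitions_of_iff M_bar_iff)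
      then show *: "?f xs \<in> partitions_of n"
        using xs by (auto simp: partitions_of_iff sorted sorted_remove1
            dest: set_remove1_subset[THEN subsetD])
      show "?f xs \<in> M_set (Suc j)"
        using xs * by (simp add: M_set_def M_bar_iff mex_f partitions_of_def)
    qed
    show "?g ` (partitions_of n \<inter> M_set (Suc j)) \<subseteq> partitions_of (n + Suc j) \<inter> M_bar j"
    proof safe
      fix ys assume ys: "ys \<in> partitions_of n" "ys \<in> M_set (Suc j)"
      then show *: "?g ys \<in> partitions_of (n + Suc j)"
        by (simp add: partitions_of_iff sorted sorted_insort set_insort_key sum_insort)
      show "?g ys \<in> M_bar j"
        using ys * by (simp add: M_set_def M_bar_iff mex_g partitions_of_def set_insort_key)
    qed
  qed
qed

section \<open>Partitions classified by the differences of parts and their indices\<close>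

lemma F_bar_iff:
  "xs \<in> F_bar j \<longleftrightarrow> xs \<in> partitions \<and> (\<exists>i<length xs. xs ! i = Suc (i + j))"
proof -
  have "(\<exists>i. int j = int (xs ! (i - 1)) - int i \<and> 1 \<le> i \<and> i \<le> length xs)
      \<longleftrightarrow> (\<exists>i<length xs. xs ! i = Suc (i + j))" (is "?L \<longleftrightarrow> ?R")
  proof
    assume ?L
    then obtain i where "int j = int (xs ! (i - 1)) - int i" "1 \<le> i" "i \<le> length xs"
      by blast
    then show ?R
      by (intro exI[of _ "i - 1"]) auto
  next
    assume ?R
    then obtain i where "i < length xs" "xs ! i = Suc (i + j)"
      by blast
    then show ?L
      by (intro exI[of _ "Suc i"]) auto
  qed
  then show ?thesis
    by (auto simp: F_bar_def F_set_def)
qed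

lemma F_set_eq: "F_set j = partitions - F_bar j"
  by (auto simp: F_bar_def F_set_def)

lemma sorted_wrt_nth_antimono:
  fixes xs :: "nat list"
  assumes "sorted_wrt (\<ge>) xs" "i \<le> k" "k < length xs"
  shows "xs ! k \<le> xs ! i"
  using assms by (cases "i = k") (auto simp: sorted_wrt_iff_nth_less)

text \<open>The pairs of the lists of parts before and after the part that witnesses membership
  in \<^term>\<open>F_bar j\<close>.\<close>

definition F_splits :: "nat \<Rightarrow> nat \<Rightarrow> (nat list \<times> nat list) set" where
  "F_splits n j = {(us, vs). us @ Suc (length us + j) # vs \<in> partitions_of n}"

text \<open>The difference of the i-th part and i strictly decreases with i, so it equals
  \<open>j\<close> at most once and a partition determines its split.\<close>

lemma card_F_bar_splits: "card (partitions_of n \<inter> F_bar j) = card (F_splits n j)"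
proof -
  let ?f = "\<lambda>(us, vs). us @ Suc (length us + j) # vs"
  have le: "length us' \<le> length us"
    if "(us', vs') \<in> F_splits n j"
      and eq: "us @ Suc (length us + j) # vs = us' @ Suc (length us' + j) # vs'" for us vs us' vs'
  proof (rule ccontr)
    assume "\<not> length us' \<le> length us"
    then have l: "length us < length us'" by simp
    \<comment> \<open>The earlier distinguished part would be an entry of \<open>us'\<close>, hence
      at least as large as the later one, although its value is smaller.\<close>
    then have "us' ! length us = Suc (length us + j)"
      using arg_cong[OF eq, of "\<lambda>xs. xs ! length us"] by (simp add: nth_append)
    moreover have "us' ! length us \<ge> Suc (length us' + j)"
      using that(1) l by (auto simp: F_splits_def partitions_of_iff sorted_wrt_append)
    ultimately show False using l by simp
  qed
  have inj: "inj_on ?f (F_splits n j)"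
  proof (rule inj_onI, unfold split_paired_all prod.case prod.inject)
    fix us vs us' vs'
    assume s: "(us, vs) \<in> F_splits n j"
      and s': "(us', vs') \<in> F_splits n j"
      and eq: "us @ Suc (length us + j) # vs = us' @ Suc (length us' + j) # vs'"
    have "length us = length us'"
      by (rule le_antisym) (fact le[OF s eq[symmetric]], fact le[OF s' eq])
    with eq show "us = us' \<and> vs = vs'" by simp
  qed
  have image: "?f ` F_splits n j = partitions_of n \<inter> F_bar j"
  proof (intro equalityI subsetI)
    fix xs assume "xs \<in> ?f ` F_splits n j"
    then obtain us vs where "xs = us @ Suc (length us + j) # vs" "xs \<in> partitions_of n"
      by (auto simp: F_splits_def)
    then show "xs \<in> partitions_of n \<inter> F_bar j"
      by (auto simp: F_bar_iff partitions_of_def intro!: exI[of _ "length us"])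
  next
    fix xs assume xs: "xs \<in> partitions_of n \<inter> F_bar j"
    then obtain i where i: "i < length xs" "xs ! i = Suc (i + j)"
      by (auto simp: F_bar_iff)
    then have eq: "xs = take i xs @ Suc (length (take i xs) + j) # drop (Suc i) xs"
      using id_take_nth_drop[of i xs] by simp
    have "(take i xs, drop (Suc i) xs) \<in> F_splits n j"
      using xs by (simp only: F_splits_def mem_Collect_eq prod.case flip: eq) simp
    with eq show "xs \<in> ?f ` F_splits n j"
      by (intro image_eqI) (auto simp only: prod.case)
  qed
  show ?thesis
    using card_image[OF inj] unfolding image by simp
qed

text \<open>In the image, the difference of part and index exceeds \<open>Suc j\<close> throughout
  the raised prefix and is below \<open>Suc j\<close> afterwards, so it skips \<open>Suc j\<close>.
  Conversely, the place of this jump recovers the prefix. The weight falls by \<open>Suc j\<close>,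
  as the deleted part is \<open>Suc (length us + j)\<close> and the prefix gains
  \<open>length us\<close>.\<close>

lemma card_F_set_splits: "card (partitions_of n \<inter> F_set (Suc j)) = card (F_splits (n + Suc j) j)"
proof -
  let ?f = "\<lambda>(us, vs). map Suc us @ vs"
  have us: "Suc (length us + j) \<le> u" if "(us, vs) \<in> F_splits (n + Suc j) j" "u \<in> set us" for us vs u
    using that by (auto simp: F_splits_def partitions_of_iff sorted_wrt_append)
  have vs: "v \<le> Suc (length us + j)" if "(us, vs) \<in> F_splits (n + Suc j) j" "v \<in> set vs" for us vs v
    using that by (auto simp: F_splits_def partitions_of_iff sorted_wrt_append)
  have sum_Suc: "sum_list (map Suc us) = sum_list us + length us" for us
    by (induction us) auto
  have le: "length us' \<le> length us"
    if s: "(us, vs) \<in> F_splits (n + Suc j) j" "(us', vs') \<in> F_splits (n + Suc j) j"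
      and eq: "map Suc us @ vs = map Suc us' @ vs'" for us vs us' vs'
  proof (rule ccontr)
    assume "\<not> length us' \<le> length us"
    then have l: "length us < length us'" by simp
    then have v: "vs \<noteq> []"
      using arg_cong[OF eq, of length] by auto
    then have "vs ! 0 = Suc (us' ! length us)"
      using l arg_cong[OF eq, of "\<lambda>xs. xs ! length us"] by (simp add: nth_append)
    moreover have "us' ! length us \<ge> Suc (length us' + j)"
      using us[OF s(2)] l by simp
    moreover have "vs ! 0 \<le> Suc (length us + j)"
      using vs[OF s(1)] v by simp
    ultimately show False using l by simp
  qed
  have inj: "inj_on ?f (F_splits (n + Suc j) j)"
  proof (rule inj_onI, unfold split_paired_all prod.case prod.inject)
    fix us vs us' vs'
    assume s: "(us, vs) \<in> F_splits (n + Suc j) j"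
      and s': "(us', vs') \<in> F_splits (n + Suc j) j"
      and eq: "map Suc us @ vs = map Suc us' @ vs'"
    have "length us = length us'"
      by (rule le_antisym) (fact le[OF s' s eq[symmetric]], fact le[OF s s' eq])
    then have "map Suc us = map Suc us' \<and> vs = vs'"
      using eq append_eq_append_conv[of "map Suc us" "map Suc us'" vs vs'] by simp
    then show "us = us' \<and> vs = vs'"
      by (simp add: inj_map_eq_map)
  qed
  have image: "?f ` F_splits (n + Suc j) j = partitions_of n \<inter> F_set (Suc j)"
  proof (intro equalityI subsetI)
    fix ys assume "ys \<in> ?f ` F_splits (n + Suc j) j"
    then obtain us vs where s: "(us, vs) \<in> F_splits (n + Suc j) j" and ys: "ys = map Suc us @ vs"
      by auto
    have p: "ys \<in> partitions_of n"
      using s unfolding ys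
      by (auto simp: F_splits_def partitions_of_iff sorted_wrt_append sorted_wrt_map sum_Suc
          le_SucI)
    moreover have "ys ! i \<noteq> Suc (i + Suc j)" if i: "i < length ys" for i
    proof (cases "i < length us")
      case True
      then show ?thesis
        using us[OF s, of "us ! i"] by (simp add: ys nth_append)
    next
      case False
      then show ?thesis
        using vs[OF s, of "vs ! (i - length us)"] i by (auto simp: ys nth_append)
    qed
    ultimately show "ys \<in> partitions_of n \<inter> F_set (Suc j)"
      by (auto simp: F_set_eq F_bar_iff partitions_of_def)
  next
    fix ys assume "ys \<in> partitions_of n \<inter> F_set (Suc j)"
    then have sorted: "sorted_wrt (\<ge>) ys" and pos: "0 \<notin> set ys" and sum: "sum_list ys = n"
      and F: "\<And>i. i < length ys \<Longrightarrow> ys ! i \<noteq> Suc (i + Suc j)"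
      by (auto simp: partitions_of_iff F_set_eq F_bar_iff)
    \<comment> \<open>This is the place of the jump. The guard lets \<open>length ys\<close> qualify
      vacuously, so the minimum exists even if all parts are large.\<close>
    define i where "i = (LEAST i. i < length ys \<longrightarrow> ys ! i \<le> Suc (i + j))"
    have i: "i < length ys \<longrightarrow> ys ! i \<le> Suc (i + j)"
      unfolding i_def by (rule LeastI[of _ "length ys"]) simp
    have i_le: "i \<le> length ys"
      unfolding i_def by (rule Least_le) simp
    define us vs where "us = map (\<lambda>y. y - 1) (take i ys)" and "vs = drop i ys"
    have len: "length us = i"
      using i_le by (simp add: us_def)
    have take_ge: "Suc (Suc (i + j)) \<le> y" if "y \<in> set (take i ys)" for y
    proof -
      from that obtain k where k: "k < i" "y = ys ! k"
        using i_le by (auto simp: in_set_conv_nth)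
      \<comment> \<open>Minimality of \<open>i\<close> gives a value of at least
        \<open>Suc (i + j)\<close> at \<open>i - 1\<close>, and membership in
        \<open>F_set (Suc j)\<close> excludes equality. Monotonicity extends the bound to all
        earlier entries.\<close>
      have "ys ! (i - 1) > Suc (i - 1 + j)"
        using not_less_Least[of "i - 1" "\<lambda>i. i < length ys \<longrightarrow> ys ! i \<le> Suc (i + j)"] k
        by (auto simp: i_def[symmetric])
      moreover have "i - 1 < length ys"
        using k i_le by simp
      ultimately have "ys ! (i - 1) \<ge> Suc (Suc (i + j))"
        using F[of "i - 1"] k by simp
      also have "ys ! (i - 1) \<le> y"
        unfolding k using sorted_wrt_nth_antimono[OF sorted, of k "i - 1"] k i_le by auto
      finally show ?thesis .
    qed
    have drop_le: "y \<le> Suc (i + j)" if "y \<in> set vs" for y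
    proof -
      from that obtain k where k: "i + k < length ys" "y = ys ! (i + k)"
        unfolding vs_def in_set_conv_nth by (metis length_drop less_diff_conv add.commute nth_drop i_le)
      then show ?thesis
        using i sorted_wrt_nth_antimono[OF sorted, of i "i + k"] by auto
    qed
    have "map Suc us = map id (take i ys)"
      unfolding us_def map_map by (rule map_cong) (auto dest: take_ge)
    then have ys: "map Suc us @ vs = ys"
      by (simp add: vs_def)
    have us_ge: "Suc (i + j) \<le> u" if "u \<in> set us" for u
      using that by (auto simp: us_def dest: take_ge)
    have "sum_list us + i + sum_list vs = n"
      using sum ys sum_Suc[of us] len by (metis sum_list_append)
    moreover have "sorted_wrt (\<ge>) us" "sorted_wrt (\<ge>) vs"
      using sorted unfolding ys[symmetric] by (auto simp: sorted_wrt_append sorted_wrt_map)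
    moreover have "0 \<notin> set us" "0 \<notin> set vs"
      using us_ge pos by (auto simp: vs_def dest: in_set_dropD)
    \<comment> \<open>The inserted part \<open>Suc (i + j)\<close> fits in order: it is a lower
      bound for \<open>us\<close> and an upper bound for \<open>vs\<close>.\<close>
    ultimately have "us @ Suc (length us + j) # vs \<in> partitions_of (n + Suc j)"
      using us_ge drop_le
      by (auto simp: partitions_of_iff sorted_wrt_append len intro: order_trans[of _ "Suc (i + j)"])
    then have "(us, vs) \<in> F_splits (n + Suc j) j"
      by (simp add: F_splits_def)
    then show "ys \<in> ?f ` F_splits (n + Suc j) j"
      using ys by (intro image_eqI) (auto simp only: prod.case)
  qed
  show ?thesis
    using card_image[OF inj] unfolding image by simp
qed

lemma card_F_bar:
  "card (partitions_of (n + Suc j) \<inter> F_bar j) = card (partitions_of n \<inter> F_set (Suc j))"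
  by (simp only: card_F_bar_splits card_F_set_splits)

section \<open>Small weights and the induction\<close>

lemma partitions_of_less_M_bar:
  assumes "n < Suc j"
  shows "partitions_of n \<inter> M_bar j = {}"
  using assms by (auto simp: M_bar_iff partitions_of_def dest!: member_le_sum_list)

lemma partitions_of_less_F_bar:
  assumes "n < Suc j"
  shows "partitions_of n \<inter> F_bar j = {}"
proof -
  have "\<not> (i < length xs \<and> xs ! i = Suc (i + j))" if "sum_list xs = n" for xs i
    using that assms member_le_sum_list[of "xs ! i" xs] nth_mem[of i xs] by fastforce
  then show ?thesis
    by (auto simp: F_bar_iff partitions_of_def)
qed

theorem corollary1p11:
  fixes j n :: nat
  shows "card (partitions_of n \<inter> M_bar j) = card (partitions_of n \<inter> F_bar j)"
proof (induction n arbitrary: j rule: less_induct)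
  case (less n)
  show ?case
  proof (cases "n < Suc j")
    case True
    then show ?thesis
      by (simp add: partitions_of_less_M_bar partitions_of_less_F_bar)
  next
    case False
    define m where "m = n - Suc j"
    have n: "n = m + Suc j"
      using False by (simp add: m_def)
    \<comment> \<open>The bijections end in \<open>M_set\<close> and \<open>F_set\<close>, while the
      induction hypothesis concerns their complements among the same finitely many
      partitions.\<close>
    have compl: "card (partitions_of m \<inter> (partitions - A)) = card (partitions_of m) - card (partitions_of m \<inter> A)"
      for A
    proof -
      have "partitions_of m \<inter> (partitions - A) = partitions_of m - (partitions_of m \<inter> A)"
        by (auto simp: partitions_of_def)
      then show ?thesis
        by (simp add: card_Diff_subset finite_partitions_of)
    qed
    have "card (partitions_of m \<inter> M_bar (Suc j)) = card (partitions_of m \<inter> F_bar (Suc j))"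
      using less.IH[of m] n by simp
    then have "card (partitions_of m \<inter> M_set (Suc j)) = card (partitions_of m \<inter> F_set (Suc j))"
      by (simp only: M_set_eq F_set_eq compl)
    then show ?thesis
      unfolding n card_M_bar card_F_bar .
  qed
qed

end
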